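(* The space $\mathcal{D}_{\mathcal{B}}^{<\infty}$ of persistence diagrams on finitely many points equipped with the bottleneck distance does not coarsely embed into Hilbert space.
   Context: $\mathbb{N}=\{1,2,\dots\}$. Let $d_\infty((x_1,x_2),(y_1,y_2))=\max\{|x_1-y_1|,|x_2-y_2|\}$ on $\mathbb{R}^2$, let $T=\{(x_1,x_2)\in\mathbb{R}^2 \mid x_2>x_1\ge 0\}$, let $\Delta\notin T$ be an extra point (representing the diagonal), and put $\mathcal{D}^1=T\cup\{\Delta\}$. Define the semi-metric $\delta$ on $\mathcal{D}^1$ by $\delta=d_\infty$ on $T$, $\delta((x_1,x_2),\Delta)=\delta(\Delta,(x_1,x_2))=(x_2-x_1)/2$, $\delta(\Delta,\Delta)=0$. For $n\in\mathbb{N}$, the space of persistence diagrams on at most $n$ points is the set $\mathcal{D}^n=(\mathcal{D}^1)^n/\mathcal{S}_n$, where the symmetric group $\mathcal{S}_n$ permutes coordinates. Appending $\Delta$ gives a natural inclusion $\mathcal{D}^n\subset\mathcal{D}^{n+1}$, and $\mathcal{D}^{<\infty}=\bigcup_{n\in\mathbb{N}}\mathcal{D}^n$. For $z=(z_1,\dots,z_n)$, $z'=(z_1',\dots,z_n')$ in $\mathcal{D}^n$, put $z_i=z_i'=\Delta$ for $n<i\le 2n$ and define the bottleneck distance $$d_{\mathcal{B}}(z,z')=\min_{\varphi\in\mathcal{S}_{2n}}\max_{1\le i\le 2n}\delta(z_i,z'_{\varphi(i)}).$$ This is compatible with the inclusions, so it defines a metric $d_{\mathcal{B}}$ on $\mathcal{D}^{<\infty}$;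 set $\mathcal{D}_{\mathcal{B}}^{<\infty}=(\mathcal{D}^{<\infty},d_{\mathcal{B}})$. A function $f:X\to Y$ between metric spaces is a coarse embedding if there are non-decreasing functions $\rho_1,\rho_2:[0,\infty)\to[0,\infty)$ with $\lim_{t\to\infty}\rho_1(t)=\infty$ and $\rho_1(d(x_1,x_2))\le d(f(x_1),f(x_2))\le\rho_2(d(x_1,x_2))$ for all $x_1,x_2\in X$. $X$ coarsely embeds into Hilbert space if there is a coarse embedding of $X$ into a Hilbert space. *)

theory Defs
  imports "HOL-Analysis.Analysis" "HOL-Combinatorics.Permutations"
begin

definition dinf :: "real \<times> real \<Rightarrow> real \<times> real \<Rightarrow> real" where
  "dinf p q = max \<bar>fst p - fst q\<bar> \<bar>snd p - snd q\<bar>"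

typedef tpoint = "{(x1, x2). x2 > x1 \<and> x1 \<ge> 0} :: (real \<times> real) set"
  by (intro exI[of _ "(0, 1)"]) simp

datatype dpoint = Pt tpoint | Diag

definition half_pers :: "tpoint \<Rightarrow> real" where
  "half_pers p = (snd (Rep_tpoint p) - fst (Rep_tpoint p)) / 2"

text \<open>This is only a semi-metric: the triangle inequality fails along paths from one
  off-diagonal point to another through \<^term>\<open>Diag\<close>.\<close>

fun delta :: "dpoint \<Rightarrow> dpoint \<Rightarrow> real" where
  "delta (Pt p) (Pt q) = dinf (Rep_tpoint p) (Rep_tpoint q)"
| "delta (Pt p) Diag = half_pers p"
| "delta Diag (Pt q) = half_pers q"
| "delta Diag Diag = 0"

text \<open>Tuples are lists, with entries indexed from \<open>0\<close>. The number \<open>n\<close> of points is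
  explicit, so that \<open>bottleneck n\<close> also applies to tuples of length less than \<open>n\<close>, regarded
  as tuples of length \<open>n\<close> by appending \<^term>\<open>Diag\<close>.\<close>

definition pad :: "dpoint list \<Rightarrow> nat \<Rightarrow> dpoint" where
  "pad z i = (if i < length z then z ! i else Diag)"

definition bottleneck :: "nat \<Rightarrow> dpoint list \<Rightarrow> dpoint list \<Rightarrow> real" where
  "bottleneck n z z' =
     Min ((\<lambda>\<phi>. Max ((\<lambda>i. delta (pad z i) (pad z' (\<phi> i))) ` {..<2 * n})) ` {\<phi>. \<phi> permutes {..<2 * n}})"

text \<open>Two tuples, possibly of different lengths, represent the same element of the union of the
  spaces of diagrams on at most \<open>n\<close> points iff they agree up to reordering after
  appending copies of \<^term>\<open>Diag\<close>. The empty tuple, which is not excluded,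
  represents the same diagram as \<open>[Diag]\<close>.\<close>

definition same_diagram :: "dpoint list \<Rightarrow> dpoint list \<Rightarrow> bool" where
  "same_diagram z z' \<longleftrightarrow>
     (\<exists>k l. mset (z @ replicate k Diag) = mset (z' @ replicate l Diag))"

lemma same_diagram_alt:
  "same_diagram z z' \<longleftrightarrow>
     (\<exists>k l. mset z + replicate_mset k Diag = mset z' + replicate_mset l Diag)"
  by (simp add: same_diagram_def)

lemma equivp_same_diagram: "equivp same_diagram"
proof (rule equivpI)
  show "reflp same_diagram"
    by (auto simp: reflp_def same_diagram_def)
  show "symp same_diagram"
    by (auto simp: symp_def same_diagram_def) metis
  show "transp same_diagram"
  proof (rule transpI)
    fix x y z
    assume "same_diagram x y" "same_diagram y z"
    then obtain k l k' l' where
      1: "mset x + replicate_mset k Diag = mset y + replicate_mset l Diag" and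
      2: "mset y + replicate_mset k' Diag = mset z + replicate_mset l' Diag"
      by (auto simp: same_diagram_alt)
    have "mset x + replicate_mset (k + k') Diag =
          (mset x + replicate_mset k Diag) + replicate_mset k' Diag"
      by (simp add: multiset_eq_iff)
    also have "\<dots> = (mset y + replicate_mset k' Diag) + replicate_mset l Diag"
      unfolding 1 by (simp add: ac_simps)
    also have "\<dots> = mset z + replicate_mset (l' + l) Diag"
      unfolding 2 by (simp add: multiset_eq_iff)
    finally show "same_diagram x z"
      unfolding same_diagram_alt by blast
  qed
qed

quotient_type diagram = "dpoint list" / same_diagram
  by (rule equivp_same_diagram)

definition padded :: "nat \<Rightarrow> dpoint list \<Rightarrow> dpoint multiset" where
  "padded n z = mset z + replicate_mset (2 * n - length z) Diag"

lemma mset_map_pad: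
  assumes "length z \<le> n"
  shows "mset (map (pad z) [0..<2 * n]) = padded n z"
proof -
  have "map (pad z) [0..<2 * n] = z @ replicate (2 * n - length z) Diag"
    using assms by (intro nth_equalityI) (auto simp: pad_def nth_append)
  then show ?thesis
    by (simp add: padded_def)
qed

lemma bottleneck_le_iff_permutes:
  assumes "n \<ge> 1"
  shows "bottleneck n z z' \<le> r \<longleftrightarrow>
    (\<exists>\<phi>. \<phi> permutes {..<2 * n} \<and> (\<forall>i<2 * n. delta (pad z i) (pad z' (\<phi> i)) \<le> r))"
proof -
  have "{\<phi>. \<phi> permutes {..<2 * n}} \<noteq> {}"
    using permutes_id[of "{..<2 * n}"] by blast
  moreover have "{..<2 * n} \<noteq> {}"
    using assms by (auto simp: lessThan_empty_iff)
  ultimately show ?thesis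
    unfolding bottleneck_def by (subst Min_le_iff) (auto simp: finite_permutations)
qed

lemma bottleneck_le_iff:
  assumes "n \<ge> 1" "length z \<le> n" "length z' \<le> n"
  shows "bottleneck n z z' \<le> r \<longleftrightarrow> rel_mset (\<lambda>p q. delta p q \<le> r) (padded n z) (padded n z')"
    (is "_ \<longleftrightarrow> rel_mset ?R _ _")
proof -
  define xs where "xs = map (pad z) [0..<2 * n]"
  define ys where "ys = map (pad z') [0..<2 * n]"
  have xs: "mset xs = padded n z" and ys: "mset ys = padded n z'"
    unfolding xs_def ys_def using assms by (simp_all only: mset_map_pad)
  have len: "length xs = 2 * n" "length ys = 2 * n"
    by (auto simp: xs_def ys_def)
  have perm: "list_all2 ?R xs (permute_list \<phi> ys) \<longleftrightarrow>
      (\<forall>i<2 * n. delta (pad z i) (pad z' (\<phi> i)) \<le> r)" if "\<phi> permutes {..<2 * n}" for \<phi>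
  proof -
    have "\<phi> i < 2 * n" if "i < 2 * n" for i
      using permutes_in_image[OF \<open>\<phi> permutes _\<close>, of i] that by simp
    then show ?thesis
      using that len by (auto simp: list_all2_conv_all_nth permute_list_nth xs_def ys_def)
  qed
  have "rel_mset ?R (mset xs) (mset ys) \<longleftrightarrow> (\<exists>\<phi>. \<phi> permutes {..<2 * n} \<and> list_all2 ?R xs (permute_list \<phi> ys))"
  proof
    assume "rel_mset ?R (mset xs) (mset ys)"
    then obtain us vs where "mset us = mset xs" "mset vs = mset ys" "list_all2 ?R us vs"
      by (auto simp: rel_mset_def)
    then obtain ws where ws: "list_all2 ?R xs ws" "mset ws = mset ys"
      using list_all2_reorder_left_invariance by (metis (lifting))
    obtain \<phi> where "\<phi> permutes {..<length ys}" "permute_list \<phi> ys = ws"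
      using mset_eq_permutation[OF ws(2)] by blast
    then show "\<exists>\<phi>. \<phi> permutes {..<2 * n} \<and> list_all2 ?R xs (permute_list \<phi> ys)"
      using ws(1) len by auto
  next
    assume "\<exists>\<phi>. \<phi> permutes {..<2 * n} \<and> list_all2 ?R xs (permute_list \<phi> ys)"
    then show "rel_mset ?R (mset xs) (mset ys)"
      unfolding rel_mset_def using len mset_permute_list by metis
  qed
  then show ?thesis
    unfolding bottleneck_le_iff_permutes[OF assms(1)] using perm xs ys by auto
qed

lemma rel_mset_pairs:
  "rel_mset R A B \<longleftrightarrow>
     (\<exists>C. image_mset fst C = A \<and> image_mset snd C = B \<and> (\<forall>(p, q) \<in># C. R p q))"
  unfolding multiset.in_rel by blast

lemma size_filter_eq_count_image: "size {#x \<in># C. f x = d#} = count (image_mset f C) d"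
  by (induction C) auto

lemma rel_mset_cancel_one:
  assumes rel: "rel_mset R (add_mset d A) (add_mset d B)"
    and count: "size A < count A d + count B d + 1" and size: "size A = size B"
  shows "rel_mset R A B"
proof -
  obtain C where C: "image_mset fst C = add_mset d A" "image_mset snd C = add_mset d B"
      "\<forall>(p, q) \<in># C. R p q"
    using rel unfolding rel_mset_pairs by blast
  have "(d, d) \<in># C"
  proof (rule ccontr)
    assume notin: "(d, d) \<notin># C"
    have 1: "size {#x \<in># C. fst x = d#} = count A d + 1"
      using size_filter_eq_count_image[of fst d C] by (simp add: C(1))
    have 2: "size {#x \<in># C. snd x = d#} = count B d + 1"
      using size_filter_eq_count_image[of snd d C] by (simp add: C(2))
    have "{#x \<in># C. fst x = d#} + {#x \<in># C. snd x = d#} \<subseteq># C"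
      using notin by (auto simp: subseteq_mset_def not_in_iff)
    then have "size {#x \<in># C. fst x = d#} + size {#x \<in># C. snd x = d#} \<le> size C"
      by (metis size_mset_mono size_union)
    moreover have "size C = size A + 1"
      by (metis C(1) size_image_mset size_add_mset Suc_eq_plus1)
    ultimately show False
      using 1 2 count by simp
  qed
  then obtain C' where C': "C = add_mset (d, d) C'"
    by (meson multi_member_split)
  show ?thesis
    unfolding rel_mset_pairs using C unfolding C' by (intro exI[of _ C']) auto
qed

lemma rel_mset_cancel:
  assumes "rel_mset R (A + replicate_mset k d) (B + replicate_mset k d)"
    and "size A < count A d + count B d + 1" "size A = size B"
  shows "rel_mset R A B"
  using assms(1)
proof (induction k)
  case 0
  then show ?case by simp
next
  case (Suc k)
  have "rel_mset R (A + replicate_mset k d) (B + replicate_mset k d)"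
    by (rule rel_mset_cancel_one) (use Suc.prems assms in auto)
  then show ?case
    by (rule Suc.IH)
qed

lemma rel_mset_add_refl:
  assumes "rel_mset R A B" "R d d"
  shows "rel_mset R (A + replicate_mset k d) (B + replicate_mset k d)"
  using assms by (induction k) (auto intro: rel_mset_Plus)

lemma size_padded: "length z \<le> n \<Longrightarrow> size (padded n z) = 2 * n"
  by (simp add: padded_def)

lemma count_padded: "length z \<le> n \<Longrightarrow> count (padded n z) Diag \<ge> n"
  by (simp add: padded_def)

lemma padded_add:
  "length z \<le> n \<Longrightarrow> padded (n + m) z = padded n z + replicate_mset (2 * m) Diag"
  by (auto simp: padded_def multiset_eq_iff)

lemma padded_cong:
  assumes "same_diagram z z'" "length z \<le> n" "length z' \<le> n"
  shows "padded n z = padded n z'"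
proof -
  obtain k l where kl: "mset z + replicate_mset k Diag = mset z' + replicate_mset l Diag"
    using assms(1) by (auto simp: same_diagram_alt)
  have "length z + k = length z' + l"
    using arg_cong[OF kl, of size] by simp
  then have len: "l + (2 * n - length z) = k + (2 * n - length z')"
    using assms(2,3) by simp
  have "padded n z + replicate_mset k Diag =
      mset z + replicate_mset k Diag + replicate_mset (2 * n - length z) Diag"
    by (simp add: padded_def)
  also have "\<dots> = mset z' + replicate_mset (l + (2 * n - length z)) Diag"
    unfolding kl by (simp add: multiset_eq_iff)
  also have "\<dots> = padded n z' + replicate_mset k Diag"
    unfolding len by (simp add: padded_def multiset_eq_iff)
  finally show ?thesis
    by simp
qed

lemma cancel_padded:
  assumes "length z \<le> n" "length z' \<le> n"
    and "rel_mset R (padded n z + replicate_mset k Diag) (padded n z' + replicate_mset k Diag)"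
  shows "rel_mset R (padded n z) (padded n z')"
  by (rule rel_mset_cancel[OF assms(3)])
     (use size_padded[OF assms(1)] size_padded[OF assms(2)] count_padded[OF assms(1)]
        count_padded[OF assms(2)] in auto)

lemma half_pers_pos: "half_pers p > 0"
  using Rep_tpoint[of p] by (auto simp: half_pers_def split: prod.splits)

lemma delta_nonneg: "delta p q \<ge> 0"
  by (cases p; cases q) (auto simp: dinf_def less_imp_le[OF half_pers_pos])

lemma delta_self: "delta p p = 0"
  by (cases p) (auto simp: dinf_def)

lemma delta_commute: "delta p q = delta q p"
  by (cases p; cases q) (auto simp: dinf_def abs_minus_commute)

lemma delta_zeroD: "delta p q \<le> 0 \<Longrightarrow> p = q"
proof (cases p; cases q)
  fix a b
  assume "delta p q \<le> 0" "p = Pt a" "q = Pt b"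
  then have "Rep_tpoint a = Rep_tpoint b"
    by (auto simp: dinf_def prod_eq_iff)
  then show "p = q"
    using \<open>p = Pt a\<close> \<open>q = Pt b\<close> by (simp add: Rep_tpoint_inject)
qed (use half_pers_pos in \<open>auto simp: not_le[symmetric]\<close>)

lemma dinf_triangle: "dinf p r \<le> dinf p q + dinf q r"
  by (auto simp: dinf_def)

lemma half_pers_le: "half_pers p \<le> dinf (Rep_tpoint p) (Rep_tpoint q) + half_pers q"
proof -
  have "\<bar>fst (Rep_tpoint p) - fst (Rep_tpoint q)\<bar> \<le> dinf (Rep_tpoint p) (Rep_tpoint q)"
    "\<bar>snd (Rep_tpoint p) - snd (Rep_tpoint q)\<bar> \<le> dinf (Rep_tpoint p) (Rep_tpoint q)"
    by (simp_all add: dinf_def)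
  then show ?thesis
    unfolding half_pers_def abs_le_iff by (simp add: field_simps)
qed

lemma delta_triangle:
  assumes "q = Diag \<Longrightarrow> p = Diag \<or> r = Diag"
  shows "delta p r \<le> delta p q + delta q r"
proof (cases p; cases r; cases q)
  fix a b c
  assume "p = Pt a" "r = Pt b" "q = Pt c"
  then show ?thesis
    by (simp add: dinf_triangle)
next
  fix b c
  assume "p = Diag" "r = Pt b" "q = Pt c"
  then show ?thesis
    using half_pers_le[of b c] delta_commute[of "Pt b" "Pt c"] by simp
next
  fix a c
  assume "p = Pt a" "r = Diag" "q = Pt c"
  then show ?thesis
    by (simp add: half_pers_le)
qed (use assms less_imp_le[OF half_pers_pos] in auto)

lemma bottleneck_nonneg:
  assumes "n \<ge> 1"
  shows "bottleneck n z z' \<ge> 0"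
proof -
  obtain \<phi> where "\<forall>i<2 * n. delta (pad z i) (pad z' (\<phi> i)) \<le> bottleneck n z z'"
    using bottleneck_le_iff_permutes[OF assms, of z z' "bottleneck n z z'"] by auto
  then have "delta (pad z 0) (pad z' (\<phi> 0)) \<le> bottleneck n z z'"
    using assms by auto
  then show ?thesis
    using delta_nonneg order_trans by blast
qed

lemma bottleneck_add:
  assumes "n \<ge> 1" "length z \<le> n" "length z' \<le> n"
  shows "bottleneck (n + m) z z' = bottleneck n z z'"
proof -
  have "bottleneck (n + m) z z' \<le> r \<longleftrightarrow> bottleneck n z z' \<le> r" if "r \<ge> 0" for r
    using assms that
    by (auto simp: bottleneck_le_iff padded_add intro: cancel_padded rel_mset_add_refl)
  then show ?thesis
    using assms(1) bottleneck_nonneg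
    by (metis order.refl order.antisym trans_le_add1)
qed

lemma bottleneck_cong:
  assumes "n \<ge> 1" "length w \<le> n" "length w' \<le> n" "length z \<le> n" "length z' \<le> n"
    and "same_diagram w z" "same_diagram w' z'"
  shows "bottleneck n w w' = bottleneck n z z'"
proof -
  have "bottleneck n w w' \<le> r \<longleftrightarrow> bottleneck n z z' \<le> r" for r
    using assms padded_cong[of w z n] padded_cong[of w' z' n] by (simp add: bottleneck_le_iff)
  then show ?thesis
    by (metis order.refl order.antisym)
qed

definition common_size :: "dpoint list \<Rightarrow> dpoint list \<Rightarrow> nat" where
  "common_size z z' = max 1 (max (length z) (length z'))"

lemma bottleneck_common_size:
  assumes "n \<ge> 1" "length z \<le> n" "length z' \<le> n"
  shows "bottleneck (common_size z z') z z' = bottleneck n z z'"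
proof -
  have "common_size z z' \<le> n"
    using assms by (auto simp: common_size_def)
  then obtain m where "n = common_size z z' + m"
    using le_Suc_ex by blast
  moreover have "common_size z z' \<ge> 1" "length z \<le> common_size z z'" "length z' \<le> common_size z z'"
    by (auto simp: common_size_def)
  ultimately show ?thesis
    using bottleneck_add by simp
qed

lift_definition bottleneck_dist :: "diagram \<Rightarrow> diagram \<Rightarrow> real"
  is "\<lambda>z z'. bottleneck (common_size z z') z z'"
proof -
  fix w z w' z'
  assume same: "same_diagram w z" "same_diagram w' z'"
  define n where "n = max 1 (length w + length w' + length z + length z')"
  have n: "n \<ge> 1" "length w \<le> n" "length w' \<le> n" "length z \<le> n" "length z' \<le> n"
    by (auto simp: n_def)
  show "bottleneck (common_size w w') w w' = bottleneck (common_size z z') z z'"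
    using bottleneck_common_size[OF n(1) n(2) n(3)] bottleneck_common_size[OF n(1) n(4) n(5)]
      bottleneck_cong[OF n same] by simp
qed

lemma bottleneck_dist_abs:
  assumes "n \<ge> 1" "length z \<le> n" "length z' \<le> n"
  shows "bottleneck_dist (abs_diagram z) (abs_diagram z') = bottleneck n z z'"
  using bottleneck_common_size[OF assms] by (simp add: bottleneck_dist.abs_eq)

lemma rel_mset_relcompp_delta:
  assumes "rel_mset Q A B" "Q = (\<lambda>p q. delta p q \<le> r) OO (\<lambda>p q. delta p q \<le> s)"
  shows "\<exists>k. rel_mset (\<lambda>p q. delta p q \<le> r + s)
    (A + replicate_mset k Diag) (B + replicate_mset k Diag)"
  using assms
proof (induction Q A B rule: rel_mset_induct)
  case empty
  have "rel_mset (\<lambda>p q. delta p q \<le> r + s) {#} {#}"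
    by (rule rel_mset_Zero)
  then show ?case
    by (intro exI[of _ 0]) simp
next
  case (add Q a b A' B')
  obtain k where k: "rel_mset (\<lambda>p q. delta p q \<le> r + s)
      (A' + replicate_mset k Diag) (B' + replicate_mset k Diag)"
    using add.IH[OF add.prems] by blast
  obtain c where c: "delta a c \<le> r" "delta c b \<le> s"
    using add.hyps(1) add.prems by blast
  show ?case
  proof (cases "delta a b \<le> r + s")
    case True
    then show ?thesis
      using rel_mset_Plus[OF _ k, of a b] by (intro exI[of _ k]) simp
  next
    case False
    then have "c = Diag"
      using delta_triangle[of c a b] c by force
    then have "delta a Diag \<le> r + s" "delta Diag b \<le> r + s"
      using c delta_nonneg[of a Diag] delta_nonneg[of Diag b] by auto
    then have "rel_mset (\<lambda>p q. delta p q \<le> r + s)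
      (add_mset a (add_mset Diag (A' + replicate_mset k Diag)))
      (add_mset Diag (add_mset b (B' + replicate_mset k Diag)))"
      using k by (intro rel_mset_Plus)
    then show ?thesis
      by (intro exI[of _ "Suc k"]) (simp add: add_mset_commute)
  qed
qed

instantiation diagram :: metric_space
begin

definition dist_diagram :: "diagram \<Rightarrow> diagram \<Rightarrow> real" where
  "dist_diagram = bottleneck_dist"

definition uniformity_diagram :: "(diagram \<times> diagram) filter" where
  "uniformity_diagram = (INF e\<in>{0<..}. principal {(x, y). dist x y < e})"

definition open_diagram :: "diagram set \<Rightarrow> bool" where
  "open_diagram U \<longleftrightarrow> (\<forall>x\<in>U. eventually (\<lambda>(x', y). x' = x \<longrightarrow> y \<in> U) uniformity)"

instance
proof
  show "uniformity = (INF e\<in>{0<..}. principal {(x, y :: diagram). dist x y < e})"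
    by (rule uniformity_diagram_def)
  show "open U \<longleftrightarrow> (\<forall>x\<in>U. eventually (\<lambda>(x', y). x' = x \<longrightarrow> y \<in> U) uniformity)"
    for U :: "diagram set"
    by (rule open_diagram_def)
next
  fix x y :: diagram
  obtain v w where vw: "x = abs_diagram v" "y = abs_diagram w"
    by (metis Quotient_abs_rep[OF Quotient_diagram])
  define n where "n = max 1 (length v + length w)"
  have n: "n \<ge> 1" "length v \<le> n" "length w \<le> n"
    by (auto simp: n_def)
  have dist: "dist x y = bottleneck n v w"
    unfolding dist_diagram_def vw using n by (rule bottleneck_dist_abs)
  show "dist x y = 0 \<longleftrightarrow> x = y"
  proof
    assume "dist x y = 0"
    then have "rel_mset (\<lambda>p q. delta p q \<le> 0) (padded n v) (padded n w)"
      using bottleneck_le_iff[OF n, of 0] dist by simp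
    then have "rel_mset (=) (padded n v) (padded n w)"
      by (rule multiset.rel_mono_strong) (rule delta_zeroD)
    then have "padded n v = padded n w"
      by (simp add: multiset.rel_eq)
    then have "same_diagram v w"
      unfolding same_diagram_alt padded_def by blast
    then show "x = y"
      by (simp add: vw diagram.abs_eq_iff)
  next
    assume "x = y"
    then have "dist x y = bottleneck n v v"
      unfolding dist_diagram_def vw(1) using n by (metis bottleneck_dist_abs vw(1))
    moreover have "bottleneck n v v \<le> 0"
      using n by (subst bottleneck_le_iff) (auto intro!: multiset.rel_refl simp: delta_self)
    ultimately show "dist x y = 0"
      using bottleneck_nonneg[OF n(1)] by (metis order.antisym)
  qed
next
  fix x y z :: diagram
  obtain u v w where uvw: "x = abs_diagram u" "y = abs_diagram v" "z = abs_diagram w"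
    by (metis Quotient_abs_rep[OF Quotient_diagram])
  define n where "n = max 1 (length u + length v + length w)"
  have n: "n \<ge> 1" "length u \<le> n" "length v \<le> n" "length w \<le> n"
    by (auto simp: n_def)
  define r s where "r = bottleneck n u w" and "s = bottleneck n v w"
  have "rel_mset (\<lambda>p q. delta p q \<le> r) (padded n u) (padded n w)"
    using bottleneck_le_iff[OF n(1,2,4), of r] by (simp add: r_def)
  moreover have "rel_mset (\<lambda>p q. delta p q \<le> s) (padded n w) (padded n v)"
  proof -
    have "rel_mset (\<lambda>p q. delta p q \<le> s) (padded n v) (padded n w)"
      using bottleneck_le_iff[OF n(1,3,4), of s] by (simp add: s_def)
    then have "rel_mset (\<lambda>p q. delta p q \<le> s)\<inverse>\<inverse> (padded n w) (padded n v)"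
      unfolding multiset.rel_flip .
    then show ?thesis
      by (rule multiset.rel_mono_strong) (simp add: delta_commute)
  qed
  ultimately have "rel_mset ((\<lambda>p q. delta p q \<le> r) OO (\<lambda>p q. delta p q \<le> s))
      (padded n u) (padded n v)"
    unfolding multiset.rel_compp by blast
  then have "rel_mset (\<lambda>p q. delta p q \<le> r + s) (padded n u) (padded n v)"
    using rel_mset_relcompp_delta[OF _ refl] cancel_padded[OF n(2,3)] by blast
  then have "bottleneck n u v \<le> r + s"
    using bottleneck_le_iff[OF n(1,2,3)] by blast
  then show "dist x y \<le> dist x z + dist y z"
    unfolding dist_diagram_def uvw r_def s_def using n by (simp add: bottleneck_dist_abs)
qed

end

lemma dist_abs_diagram:
  "n \<ge> 1 \<Longrightarrow> length z \<le> n \<Longrightarrow> length z' \<le> n \<Longrightarrow>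
   dist (abs_diagram z) (abs_diagram z') = bottleneck n z z'"
  by (simp add: dist_diagram_def bottleneck_dist_abs)

text \<open>Control functions are defined on all of \<^typ>\<open>real\<close>, but only their values on
  \<open>[0, \<infinity>)\<close> are constrained or used.\<close>

definition coarse_embedding :: "('a::metric_space \<Rightarrow> 'b::metric_space) \<Rightarrow> bool" where
  "coarse_embedding f \<longleftrightarrow>
     (\<exists>\<rho>1 \<rho>2 :: real \<Rightarrow> real.
        mono_on {0..} \<rho>1 \<and> mono_on {0..} \<rho>2 \<and>
        (\<forall>t\<ge>0. \<rho>1 t \<ge> 0 \<and> \<rho>2 t \<ge> 0) \<and>
        filterlim \<rho>1 at_top at_top \<and>
        (\<forall>x y. \<rho>1 (dist x y) \<le> dist (f x) (f y) \<and> dist (f x) (f y) \<le> \<rho>2 (dist x y)))"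

end

theory Submission
  imports Defs
begin

text \<open>
  The space of diagrams contains isometric copies of all finite metric spaces, and some
  sequences of finite metric spaces have no coarse embeddings into Hilbert space with common
  control functions.

  The sequence used here consists of the spaces of \<open>t \<times> t\<close> matrices over the field with two
  elements with the distance \<open>rank (M - N)\<close>. Encode a matrix as the set \<open>M \<subseteq> A \<times> A\<close> of
  positions of its ones, where \<open>card A = t\<close>. Addition becomes symmetric difference, and the
  matrices of rank at most one are the rectangles \<open>X \<times> Y\<close>, so that the rank of \<open>M\<close> is the least
  number of rectangles whose symmetric difference is \<open>M\<close>. Two properties of the graph in which
  \<open>M\<close> is joined to all \<open>sym_diff M (X \<times> Y)\<close> are in conflict with each other in Hilbert space.

  \<^item> It has a spectral gap that does not depend on \<open>t\<close>. Every nontrivial character of the group of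
    matrices has mean at most \<open>1/2\<close> over the rectangles (\<open>sum_walsh_rectangles\<close>). By Fourier
    analysis (\<open>poincare_power_set\<close>) the mean square distance between the images of two arbitrary
    vertices under a map into Hilbert space is at most twice the mean square length of the images
    of the edges.

  \<^item> Most pairs of vertices are far apart. There are \<open>4 ^ t\<close> pairs \<open>(X, Y)\<close>, hence at most
    \<open>2 ^ (2 * t * r)\<close> matrices of rank at most \<open>r\<close> (\<open>card_rect_ball\<close>), and this is at most half of
    all \<open>2 ^ (t * t)\<close> matrices if \<open>t = 2 * r + 1\<close>.

  For the passage to diagrams (\<open>cube_embeds_in_diagrams\<close>), assign to each coordinate of a point of
  the cube \<open>[0, D]\<^sup>N\<close> one off-diagonal point whose death time is shifted by that coordinate. If these
  points are far from each other and from the diagonal, no matching is better than the obvious one,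
  and the bottleneck distance is the supremum distance. Composing this with the coordinates
  \<open>M \<mapsto> min r (rank (M - W))\<close>, one for each matrix \<open>W\<close>, keeps neighbours at distance at most \<open>1\<close> and
  matrices whose difference has rank greater than \<open>r\<close> at distance at least \<open>r\<close>. A coarse embedding
  with control functions \<open>\<rho>1\<close> and \<open>\<rho>2\<close> would therefore satisfy \<open>\<rho>1 r \<le> 2 * \<rho>2 1\<close> for all \<open>r\<close>
  (\<open>compression_bound\<close>), although \<open>\<rho>1\<close> is unbounded.
\<close>

section \<open>Fourier analysis on the power set group\<close>

text \<open>The characters of the group of subsets of a finite set under symmetric
  difference; they are themselves indexed by subsets.\<close>

definition walsh :: "'a set \<Rightarrow> 'a set \<Rightarrow> real" where
  "walsh B M = (-1) ^ card (B \<inter> M)"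

lemma walsh_empty [simp]: "walsh {} M = 1"
  by (simp add: walsh_def)

lemma walsh_commute: "walsh B M = walsh M B"
  by (simp add: walsh_def Int_commute)

lemma walsh_le_1: "walsh B M \<le> 1"
  by (cases "even (card (B \<inter> M))") (simp_all add: walsh_def)

lemma walsh_square [simp]: "(walsh B M)\<^sup>2 = 1"
  by (simp add: walsh_def flip: power_mult)

text \<open>The product form of the character separates the elements of \<open>B\<close>: an element lies in the
  symmetric difference iff it lies in exactly one of the two sets, and this multiplies the signs.\<close>

lemma walsh_sym_diff:
  assumes "finite B"
  shows "walsh B (sym_diff M N) = walsh B M * walsh B N"
proof -
  have walsh_prod: "walsh B K = (\<Prod>x\<in>B. if x \<in> K then -1 else 1)" for K
    using assms by (simp add: walsh_def prod.If_cases)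
  show ?thesis
    unfolding walsh_prod prod.distrib[symmetric] by (rule prod.cong) auto
qed

lemma bij_betw_sym_diff:
  assumes "s \<subseteq> A"
  shows "bij_betw (\<lambda>X. sym_diff X s) (Pow A) (Pow A)"
  by (rule bij_betw_byWitness[where f' = "\<lambda>X. sym_diff X s"]) (use assms in auto)

text \<open>A translation of the group permutes its elements and leaves the sum unchanged, but it also
  multiplies the sum by \<open>c\<close>. All cancellations of characters below are instances of this.\<close>

lemma sum_eq_0_if_translation_scales:
  fixes h :: "'a set \<Rightarrow> real"
  assumes "s \<subseteq> A" "\<And>X. X \<subseteq> A \<Longrightarrow> h (sym_diff X s) = c * h X" "c \<noteq> 1"
  shows "(\<Sum>X\<in>Pow A. h X) = 0"
proof -
  have "(\<Sum>X\<in>Pow A. h X) = (\<Sum>X\<in>Pow A. h (sym_diff X s))"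
    by (rule sum.reindex_bij_betw[OF bij_betw_sym_diff[OF assms(1)], symmetric])
  also have "\<dots> = c * (\<Sum>X\<in>Pow A. h X)"
    unfolding sum_distrib_left using assms(2) by (intro sum.cong) auto
  finally show ?thesis
    using assms(3) by simp
qed

lemma sum_walsh:
  assumes "finite A" "B \<subseteq> A"
  shows "(\<Sum>M\<in>Pow A. walsh B M) = (if B = {} then 2 ^ card A else 0)"
proof (cases "B = {}")
  case True
  then show ?thesis
    using assms by (simp add: card_Pow)
next
  case False
  then obtain b where b: "b \<in> B"
    by blast
  have "finite B"
    using assms finite_subset by blast
  moreover have "walsh B {b} = -1"
    using b by (simp add: walsh_def)
  ultimately have "(\<Sum>M\<in>Pow A. walsh B M) = 0"
    using b assms
    by (intro sum_eq_0_if_translation_scales[of "{b}" A _ "-1"])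
      (auto simp: walsh_sym_diff simp del: Un_insert_right)
  then show ?thesis
    using False by simp
qed

definition walsh_coeff :: "'a set \<Rightarrow> ('a set \<Rightarrow> 'h) \<Rightarrow> 'a set \<Rightarrow> 'h :: real_inner" where
  "walsh_coeff A f B = (\<Sum>M\<in>Pow A. walsh B M *\<^sub>R f M)"

lemma walsh_parseval:
  fixes f :: "'a set \<Rightarrow> 'h :: real_inner"
  assumes "finite A"
  shows "(\<Sum>B\<in>Pow A. (norm (walsh_coeff A f B))\<^sup>2) = 2 ^ card A * (\<Sum>M\<in>Pow A. (norm (f M))\<^sup>2)"
proof -
  have fin: "finite M" if "M \<in> Pow A" for M
    using that assms finite_subset by blast
  have "(norm (walsh_coeff A f B))\<^sup>2 =
      (\<Sum>M\<in>Pow A. \<Sum>N\<in>Pow A. walsh (sym_diff M N) B * inner (f M) (f N))"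
    if "B \<in> Pow A" for B
    unfolding power2_norm_eq_inner walsh_coeff_def inner_sum_left inner_sum_right
    using walsh_sym_diff[OF fin[OF that]]
    by (simp add: walsh_commute[of _ B] sum_distrib_left mult_ac inner_commute)
  then have "(\<Sum>B\<in>Pow A. (norm (walsh_coeff A f B))\<^sup>2) =
      (\<Sum>B\<in>Pow A. \<Sum>M\<in>Pow A. \<Sum>N\<in>Pow A. walsh (sym_diff M N) B * inner (f M) (f N))"
    by (rule sum.cong[OF refl])
  also have "\<dots> = (\<Sum>M\<in>Pow A. \<Sum>B\<in>Pow A. \<Sum>N\<in>Pow A. walsh (sym_diff M N) B * inner (f M) (f N))"
    by (rule sum.swap)
  also have "\<dots> = (\<Sum>M\<in>Pow A. \<Sum>N\<in>Pow A. \<Sum>B\<in>Pow A. walsh (sym_diff M N) B * inner (f M) (f N))"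
    by (intro sum.cong refl sum.swap)
  also have "\<dots> = (\<Sum>M\<in>Pow A. \<Sum>N\<in>Pow A. if N = M then 2 ^ card A * inner (f M) (f N) else 0)"
  proof (intro sum.cong refl)
    fix M N
    assume MN: "M \<in> Pow A" "N \<in> Pow A"
    then have "sym_diff M N \<subseteq> A" "sym_diff M N = {} \<longleftrightarrow> N = M"
      by auto
    then show "(\<Sum>B\<in>Pow A. walsh (sym_diff M N) B * inner (f M) (f N)) =
        (if N = M then 2 ^ card A * inner (f M) (f N) else 0)"
      using assms by (simp add: sum_distrib_right[symmetric] sum_walsh)
  qed
  also have "\<dots> = (\<Sum>M\<in>Pow A. 2 ^ card A * (norm (f M))\<^sup>2)"
    using assms by (simp add: sum.delta power2_norm_eq_inner)
  finally show ?thesis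
    by (simp add: sum_distrib_left)
qed

text \<open>Translations are diagonal in the basis of characters.\<close>

lemma walsh_coeff_translation_difference:
  assumes "finite A" "B \<subseteq> A" "s \<subseteq> A"
  shows "walsh_coeff A (\<lambda>M. f M - f (sym_diff M s)) B = (1 - walsh B s) *\<^sub>R walsh_coeff A f B"
proof -
  have "finite B"
    using assms finite_subset by blast
  then have eq: "walsh B M = walsh B s * walsh B (sym_diff M s)" for M
    by (simp add: walsh_sym_diff mult.left_commute[of "walsh B s"] flip: power2_eq_square)
  have "(\<Sum>M\<in>Pow A. walsh B M *\<^sub>R f (sym_diff M s)) =
      (\<Sum>M\<in>Pow A. (walsh B s * walsh B (sym_diff M s)) *\<^sub>R f (sym_diff M s))"
    by (subst eq) (rule refl)
  also have "\<dots> = (\<Sum>M\<in>Pow A. (walsh B s * walsh B M) *\<^sub>R f M)"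
    by (rule sum.reindex_bij_betw[OF bij_betw_sym_diff[OF assms(3)]])
  also have "\<dots> = walsh B s *\<^sub>R walsh_coeff A f B"
    by (simp add: walsh_coeff_def scaleR_sum_right)
  finally show ?thesis
    by (simp add: walsh_coeff_def algebra_simps sum_subtractf)
qed

text \<open>Parseval's identity for \<open>f M - f (sym_diff M s)\<close>. The factor \<open>(1 - walsh B s)\<^sup>2\<close> equals
  \<open>2 * (1 - walsh B s)\<close> since the character takes the values \<open>1\<close> and \<open>-1\<close> only. That the right-hand side
  is affine in the character makes it possible to average over \<open>s\<close>.\<close>

lemma translation_energy:
  fixes f :: "'a set \<Rightarrow> 'h :: real_inner"
  assumes "finite A" "s \<subseteq> A"
  shows "2 ^ card A * (\<Sum>M\<in>Pow A. (norm (f M - f (sym_diff M s)))\<^sup>2) =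
    (\<Sum>B\<in>Pow A. 2 * (1 - walsh B s) * (norm (walsh_coeff A f B))\<^sup>2)"
proof -
  have sq: "(1 - walsh B s)\<^sup>2 = 2 * (1 - walsh B s)" for B
    by (simp add: power2_diff)
  show ?thesis
    unfolding walsh_parseval[OF assms(1), symmetric]
    using assms by (intro sum.cong refl)
      (simp add: walsh_coeff_translation_difference power_mult_distrib sq)
qed

text \<open>The spectral gap inequality of the Cayley graph with generators \<open>s i\<close>. The pairs \<open>(M, N)\<close> are
  the edges of the Cayley graph whose generators are all the group elements, so that both sides are
  energies of the same form. In terms of the Walsh coefficients, the left-hand sum weighs
  each nontrivial character by \<open>2\<close>, and the right-hand side weighs it by at least \<open>2 * (1 - c) * card I\<close>;
  the trivial character contributes nothing to either.\<close>

lemma poincare_power_set: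
  fixes f :: "'a set \<Rightarrow> 'h :: real_inner" and c :: real
  assumes A: "finite A" and s: "\<And>i. i \<in> I \<Longrightarrow> s i \<subseteq> A"
    and bias: "\<And>B. B \<subseteq> A \<Longrightarrow> B \<noteq> {} \<Longrightarrow> (\<Sum>i\<in>I. walsh B (s i)) \<le> c * card I"
  shows "(1 - c) * card I * (\<Sum>M\<in>Pow A. \<Sum>N\<in>Pow A. (norm (f M - f N))\<^sup>2) \<le>
    2 ^ card A * (\<Sum>i\<in>I. \<Sum>M\<in>Pow A. (norm (f M - f (sym_diff M (s i))))\<^sup>2)"
proof -
  define w where "w B = (norm (walsh_coeff A f B))\<^sup>2" for B
  define total where "total = (\<Sum>M\<in>Pow A. \<Sum>N\<in>Pow A. (norm (f M - f N))\<^sup>2)"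
  have energy: "2 ^ card A * (\<Sum>i\<in>J. \<Sum>M\<in>Pow A. (norm (f M - f (sym_diff M (t i))))\<^sup>2) =
      (\<Sum>B\<in>Pow A. 2 * (card J - (\<Sum>i\<in>J. walsh B (t i))) * w B)"
    if t: "\<And>i. i \<in> J \<Longrightarrow> t i \<subseteq> A" for J and t :: "'j \<Rightarrow> 'a set"
  proof -
    have "2 ^ card A * (\<Sum>i\<in>J. \<Sum>M\<in>Pow A. (norm (f M - f (sym_diff M (t i))))\<^sup>2) =
        (\<Sum>i\<in>J. \<Sum>B\<in>Pow A. 2 * (1 - walsh B (t i)) * w B)"
      unfolding sum_distrib_left[of _ _ J] w_def
      using t by (intro sum.cong refl translation_energy[OF A])
    also have "\<dots> = (\<Sum>B\<in>Pow A. \<Sum>i\<in>J. 2 * (1 - walsh B (t i)) * w B)"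
      by (rule sum.swap)
    finally show ?thesis
      by (simp add: sum_distrib_left[symmetric] sum_distrib_right[symmetric] sum_subtractf
          mult.commute[of _ 2])
  qed
  have "total = (\<Sum>M\<in>Pow A. \<Sum>N\<in>Pow A. (norm (f M - f (sym_diff M N)))\<^sup>2)"
    unfolding total_def
  proof (rule sum.cong[OF refl])
    fix M assume "M \<in> Pow A"
    then show "(\<Sum>N\<in>Pow A. (norm (f M - f N))\<^sup>2) =
        (\<Sum>N\<in>Pow A. (norm (f M - f (sym_diff M N)))\<^sup>2)"
      using sum.reindex_bij_betw[OF bij_betw_sym_diff, of M A "\<lambda>N. (norm (f M - f N))\<^sup>2"]
      by (simp add: Un_commute)
  qed
  also have "\<dots> = (\<Sum>N\<in>Pow A. \<Sum>M\<in>Pow A. (norm (f M - f (sym_diff M N)))\<^sup>2)"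
    by (rule sum.swap)
  finally have "2 ^ card A * total = (\<Sum>B\<in>Pow A. 2 * (2 ^ card A - (\<Sum>N\<in>Pow A. walsh B N)) * w B)"
    using energy[of "Pow A" "\<lambda>N. N"] A by (simp add: card_Pow)
  also have "\<dots> = 2 ^ card A * (\<Sum>B\<in>Pow A. if B = {} then 0 else 2 * w B)"
    unfolding sum_distrib_left using A by (intro sum.cong refl) (simp add: sum_walsh)
  finally have total: "total = (\<Sum>B\<in>Pow A. if B = {} then 0 else 2 * w B)"
    by simp
  have "(1 - c) * card I * total \<le> (\<Sum>B\<in>Pow A. 2 * (card I - (\<Sum>i\<in>I. walsh B (s i))) * w B)"
    unfolding total sum_distrib_left
  proof (rule sum_mono)
    fix B assume B: "B \<in> Pow A"
    show "(1 - c) * card I * (if B = {} then 0 else 2 * w B) \<le>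
        2 * (card I - (\<Sum>i\<in>I. walsh B (s i))) * w B"
    proof (cases "B = {}")
      case False
      then have "(1 - c) * card I * (2 * w B) \<le> (card I - (\<Sum>i\<in>I. walsh B (s i))) * (2 * w B)"
        using bias[of B] B by (intro mult_right_mono) (auto simp: w_def algebra_simps)
      then show ?thesis
        using False by (simp add: algebra_simps)
    qed simp
  qed
  then show ?thesis
    using energy[of I s] s by (simp add: total_def)
qed

section \<open>Rectangles and the rank metric\<close>

text \<open>With \<open>B\<close> and the rectangle read as matrices over the field with two elements, the character
  is the sign of the bilinear form \<open>x\<^sup>T B y\<close>. For fixed \<open>y\<close> the signs cancel in the sum over \<open>x\<close> unless \<open>B y = 0\<close>,
  and a nonzero \<open>B\<close> kills at most half of all \<open>y\<close>. The proof looks at a single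
  entry \<open>(i, j)\<close> of \<open>B\<close>: toggling \<open>i\<close> in \<open>X\<close> gives cancellation when row \<open>i\<close> of \<open>B\<close> meets \<open>Y\<close> in an odd
  number of places, and toggling \<open>j\<close> in \<open>Y\<close> shows that this happens for half of all \<open>Y\<close>.\<close>

lemma sum_walsh_rectangles:
  assumes A: "finite A" and B: "B \<subseteq> A \<times> A" "B \<noteq> {}"
  shows "(\<Sum>(X, Y)\<in>Pow A \<times> Pow A. walsh B (X \<times> Y)) \<le> 1 / 2 * card (Pow A \<times> Pow A)"
proof -
  obtain i j where ij: "(i, j) \<in> B"
    using B(2) by auto
  then have ijA: "i \<in> A" "j \<in> A"
    using B(1) by auto
  have "finite B"
    using A B(1) finite_subset by blast
  note mult = walsh_sym_diff[OF this]
  have "sym_diff X {i} \<times> Y = sym_diff (X \<times> Y) ({i} \<times> Y)" for X Y :: "'a set"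
    by auto
  then have toggle: "walsh B (sym_diff X {i} \<times> Y) = walsh B ({i} \<times> Y) * walsh B (X \<times> Y)" for X Y
    using mult by (metis mult.commute)
  have row: "(\<Sum>X\<in>Pow A. walsh B (X \<times> Y)) \<le> 2 ^ card A * ((1 + walsh B ({i} \<times> Y)) / 2)" for Y
  proof (cases "walsh B ({i} \<times> Y) = 1")
    case True
    have "(\<Sum>X\<in>Pow A. walsh B (X \<times> Y)) \<le> (\<Sum>X\<in>Pow A. 1)"
      by (rule sum_mono) (rule walsh_le_1)
    then show ?thesis
      using True A by (simp add: card_Pow)
  next
    case False
    then have "(\<Sum>X\<in>Pow A. walsh B (X \<times> Y)) = 0"
      using ijA toggle by (intro sum_eq_0_if_translation_scales[of "{i}" A]) auto
    moreover have "walsh B ({i} \<times> Y) = -1"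
      using False walsh_square[of B "{i} \<times> Y"] unfolding power2_eq_1_iff by simp
    ultimately show ?thesis
      by simp
  qed
  have "{i} \<times> sym_diff Y {j} = sym_diff ({i} \<times> Y) {(i, j)}" for Y :: "'a set"
    by auto
  moreover have "walsh B {(i, j)} = -1"
    using ij by (simp add: walsh_def)
  ultimately have col: "(\<Sum>Y\<in>Pow A. walsh B ({i} \<times> Y)) = 0"
    using ijA mult by (intro sum_eq_0_if_translation_scales[of "{j}" A _ "-1"]) auto
  have "(\<Sum>(X, Y)\<in>Pow A \<times> Pow A. walsh B (X \<times> Y)) = (\<Sum>Y\<in>Pow A. \<Sum>X\<in>Pow A. walsh B (X \<times> Y))"
    unfolding sum.cartesian_product[symmetric] by (rule sum.swap)
  also have "\<dots> \<le> (\<Sum>Y\<in>Pow A. 2 ^ card A * ((1 + walsh B ({i} \<times> Y)) / 2))"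
    by (intro sum_mono row)
  also have "\<dots> = 1 / 2 * card (Pow A \<times> Pow A)"
    unfolding sum_distrib_left[symmetric] sum_divide_distrib[symmetric] sum.distrib col
    using A by (simp add: card_Pow card_cartesian_product)
  finally show ?thesis .
qed

text \<open>The ball of radius \<open>m\<close> around the zero matrix in the rank metric.\<close>

fun rect_ball :: "'a set \<Rightarrow> nat \<Rightarrow> ('a \<times> 'a) set set" where
  "rect_ball A 0 = {{}}"
| "rect_ball A (Suc m) =
    (\<lambda>(M, X, Y). sym_diff M (X \<times> Y)) ` (rect_ball A m \<times> Pow A \<times> Pow A)"

lemma rect_ball_Suc:
  assumes "M \<in> rect_ball A m" "X \<subseteq> A" "Y \<subseteq> A"
  shows "sym_diff M (X \<times> Y) \<in> rect_ball A (Suc m)"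
  using assms by (auto intro!: image_eqI[of _ _ "(M, X, Y)"])

lemma rect_ball_mono: "m \<le> n \<Longrightarrow> rect_ball A m \<subseteq> rect_ball A n"
proof (rule lift_Suc_mono_le[of "rect_ball A"])
  fix m
  show "rect_ball A m \<subseteq> rect_ball A (Suc m)"
    using rect_ball_Suc[of _ A m "{}" "{}"] by auto
qed

lemma card_rect_ball:
  assumes "finite A"
  shows "finite (rect_ball A m) \<and> card (rect_ball A m) \<le> 2 ^ (2 * card A * m)"
proof (induction m)
  case (Suc m)
  have "card (rect_ball A (Suc m)) \<le> card (rect_ball A m \<times> Pow A \<times> Pow A)"
    unfolding rect_ball.simps using Suc assms by (intro card_image_le) auto
  also have "\<dots> = card (rect_ball A m) * 2 ^ (2 * card A)"
    using assms by (simp add: card_cartesian_product card_Pow mult_2 power_add)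
  also have "\<dots> \<le> 2 ^ (2 * card A * m) * 2 ^ (2 * card A)"
    using Suc by (intro mult_right_mono) auto
  finally show ?case
    using Suc assms by (simp add: power_add mult.commute)
qed simp

text \<open>The rank truncated at \<open>r\<close>, written as the number of balls of radius less than \<open>r\<close> that miss
  \<open>M\<close>. The truncation provides the bound on coordinates that \<open>cube_embeds_in_diagrams\<close> requires.\<close>

definition rect_rank :: "'a set \<Rightarrow> nat \<Rightarrow> ('a \<times> 'a) set \<Rightarrow> nat" where
  "rect_rank A r M = card {m. m < r \<and> M \<notin> rect_ball A m}"

lemma rect_rank_le: "rect_rank A r M \<le> r"
proof -
  have "card {m. m < r \<and> M \<notin> rect_ball A m} \<le> card {..<r}"
    by (rule card_mono) auto
  then show ?thesis
    by (simp add: rect_rank_def)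
qed

lemma rect_rank_empty: "rect_rank A r {} = 0"
proof -
  have "{} \<in> rect_ball A m" for m
    using rect_ball_mono[of 0 m A] by auto
  then show ?thesis
    by (simp add: rect_rank_def)
qed

lemma rect_rank_outside:
  assumes "M \<notin> rect_ball A r"
  shows "rect_rank A r M = r"
proof -
  have "{m. m < r \<and> M \<notin> rect_ball A m} = {..<r}"
    using assms rect_ball_mono[of _ r A] by (auto dest: less_imp_le)
  then show ?thesis
    by (simp add: rect_rank_def)
qed

lemma rect_rank_step:
  assumes "X \<subseteq> A" "Y \<subseteq> A"
  shows "rect_rank A r (sym_diff M (X \<times> Y)) \<le> Suc (rect_rank A r M)"
proof -
  let ?S = "{m. m < r \<and> M \<notin> rect_ball A m}"
  have "{m. m < r \<and> sym_diff M (X \<times> Y) \<notin> rect_ball A m} \<subseteq> insert 0 (Suc ` ?S)"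
  proof
    fix m assume m: "m \<in> {m. m < r \<and> sym_diff M (X \<times> Y) \<notin> rect_ball A m}"
    show "m \<in> insert 0 (Suc ` ?S)"
    proof (cases m)
      case (Suc k)
      then show ?thesis
        using m rect_ball_Suc[OF _ assms, of M k] by auto
    qed simp
  qed
  then have "rect_rank A r (sym_diff M (X \<times> Y)) \<le> card (insert 0 (Suc ` ?S))"
    unfolding rect_rank_def by (intro card_mono) auto
  also have "\<dots> \<le> Suc (card (Suc ` ?S))"
    by (rule card_insert_le_m1) auto
  also have "card (Suc ` ?S) = card ?S"
    by (simp add: card_image)
  finally show ?thesis
    by (simp add: rect_rank_def)
qed

lemma rect_rank_lipschitz:
  assumes "X \<subseteq> A" "Y \<subseteq> A"
  shows "\<bar>real (rect_rank A r (sym_diff M (X \<times> Y))) - real (rect_rank A r M)\<bar> \<le> 1"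
proof -
  have "sym_diff (sym_diff M (X \<times> Y)) (X \<times> Y) = M"
    by auto
  then show ?thesis
    using rect_rank_step[OF assms, of r M] rect_rank_step[OF assms, of r "sym_diff M (X \<times> Y)"]
    by simp
qed

section \<open>Cubes inside the space of diagrams\<close>

text \<open>Coordinate number \<open>k\<close> becomes the point with birth time \<open>2 * D * k\<close> and persistence \<open>2 * D\<close> plus the
  value of the coordinate. Matching it with a point of another number costs at least \<open>2 * D\<close>, and
  matching it with the diagonal at least \<open>D\<close>, whereas matching points of the same number never costs more than
  \<open>D\<close>. Hence the identity is an optimal matching.\<close>

lemma cube_embeds_in_diagrams:
  fixes g :: "'v \<Rightarrow> 'i \<Rightarrow> real"
  assumes "finite I" "D > 0" and g: "\<And>v i. i \<in> I \<Longrightarrow> g v i \<in> {0..D}"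
  obtains F :: "'v \<Rightarrow> diagram"
  where "\<And>u v c. c \<ge> 0 \<Longrightarrow> dist (F u) (F v) \<le> c \<longleftrightarrow> (\<forall>i\<in>I. \<bar>g u i - g v i\<bar> \<le> c)"
proof -
  obtain e where e: "bij_betw e {..<card I} I"
    using ex_bij_betw_nat_finite[OF assms(1)] by (auto simp: atLeast0LessThan)
  define n where "n = card I"
  define x where "x k = 2 * D * real k" for k
  define p where "p v k = Abs_tpoint (x k, x k + 2 * D + g v (e k))" for v k
  define z where "z v = map (\<lambda>k. Pt (p v k)) [0..<n]" for v
  define F where "F v = abs_diagram (z v)" for v
  have range: "0 \<le> g v (e k)" "g v (e k) \<le> D" if "k < n" for v k
    using g[of "e k" v] bij_betwE[OF e] that by (auto simp: n_def)
  have Rep: "Rep_tpoint (p v k) = (x k, x k + 2 * D + g v (e k))" if "k < n" for v k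
    unfolding p_def using range[OF that, of v] assms(2)
    by (intro Abs_tpoint_inverse) (auto simp: x_def)
  have pad: "pad (z v) k = (if k < n then Pt (p v k) else Diag)" for v k
    by (simp add: pad_def z_def)
  have same: "delta (pad (z u) k) (pad (z v) k) = \<bar>g u (e k) - g v (e k)\<bar>" if "k < n" for u v k
    using that by (simp add: pad Rep dinf_def)
  have other: "delta (pad (z u) k) (pad (z v) l) \<ge> D" if "k < n" "k \<noteq> l" for u v k l
  proof (cases "l < n")
    case True
    have "1 \<le> \<bar>real k - real l\<bar>"
      using that(2) by linarith
    then have "2 * D * 1 \<le> 2 * D * \<bar>real k - real l\<bar>"
      using assms(2) by (intro mult_left_mono) auto
    also have "\<dots> = \<bar>x k - x l\<bar>"
      using assms(2) by (simp add: x_def abs_mult flip: right_diff_distrib)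
    finally have "D \<le> \<bar>x k - x l\<bar>"
      using assms(2) by simp
    then show ?thesis
      using that True by (simp add: pad Rep dinf_def)
  next
    case False
    then show ?thesis
      using that(1) range(1)[OF that(1), of u] by (simp add: pad half_pers_def Rep)
  qed
  have "dist (F u) (F v) \<le> c \<longleftrightarrow> (\<forall>i\<in>I. \<bar>g u i - g v i\<bar> \<le> c)" if c: "c \<ge> 0" for u v c
  proof -
    have "I = e ` {..<n}"
      using bij_betw_imp_surj_on[OF e] by (simp add: n_def)
    then have I: "(\<forall>i\<in>I. \<bar>g u i - g v i\<bar> \<le> c) \<longleftrightarrow> (\<forall>k<n. \<bar>g u (e k) - g v (e k)\<bar> \<le> c)"
      by auto
    \<comment> \<open>If \<open>I\<close> is empty, the diagrams are still compared as diagrams on one point.\<close>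
    define m where "m = max 1 n"
    have "dist (F u) (F v) = bottleneck m (z u) (z v)"
      unfolding F_def by (rule dist_abs_diagram) (auto simp: m_def z_def)
    then have "dist (F u) (F v) \<le> c \<longleftrightarrow>
        (\<exists>\<phi>. \<phi> permutes {..<2 * m} \<and> (\<forall>i<2 * m. delta (pad (z u) i) (pad (z v) (\<phi> i)) \<le> c))"
      using bottleneck_le_iff_permutes[of m "z u" "z v" c] by (simp add: m_def)
    also have "\<dots> \<longleftrightarrow> (\<forall>k<n. \<bar>g u (e k) - g v (e k)\<bar> \<le> c)"
    proof
      assume "\<exists>\<phi>. \<phi> permutes {..<2 * m} \<and> (\<forall>i<2 * m. delta (pad (z u) i) (pad (z v) (\<phi> i)) \<le> c)"
      then obtain \<phi> where \<phi>: "\<And>i. i < 2 * m \<Longrightarrow> delta (pad (z u) i) (pad (z v) (\<phi> i)) \<le> c"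
        by blast
      show "\<forall>k<n. \<bar>g u (e k) - g v (e k)\<bar> \<le> c"
      proof (intro allI impI)
        fix k assume k: "k < n"
        then have le: "delta (pad (z u) k) (pad (z v) (\<phi> k)) \<le> c"
          using \<phi>[of k] by (simp add: m_def)
        show "\<bar>g u (e k) - g v (e k)\<bar> \<le> c"
        proof (cases "\<phi> k = k")
          case True
          then show ?thesis
            using le same[OF k] by simp
        next
          case False
          then have "D \<le> c"
            using other[OF k, of "\<phi> k" u v] le by simp
          then show ?thesis
            using range[OF k, of u] range[OF k, of v] by linarith
        qed
      qed
    next
      assume "\<forall>k<n. \<bar>g u (e k) - g v (e k)\<bar> \<le> c"
      then have "delta (pad (z u) i) (pad (z v) (id i)) \<le> c" for i
        using same[of i u v] c by (cases "i < n") (auto simp: pad)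
      then show "\<exists>\<phi>. \<phi> permutes {..<2 * m} \<and>
          (\<forall>i<2 * m. delta (pad (z u) i) (pad (z v) (\<phi> i)) \<le> c)"
        using permutes_id by blast
    qed
    finally show ?thesis
      by (simp add: I)
  qed
  then show ?thesis
    by (rule that)
qed

text \<open>The coordinates are the truncated ranks of \<open>M - W\<close> for all matrices \<open>W\<close>. Each of them changes by at
  most one along an edge, and the coordinate \<open>W = N\<close> alone already separates \<open>M\<close> from \<open>N\<close>.\<close>

lemma rank_metric_in_diagrams:
  assumes "finite A" "r > 0"
  obtains F :: "('a \<times> 'a) set \<Rightarrow> diagram" where
    "\<And>M X Y. X \<subseteq> A \<Longrightarrow> Y \<subseteq> A \<Longrightarrow> dist (F M) (F (sym_diff M (X \<times> Y))) \<le> 1"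
    "\<And>M N. N \<subseteq> A \<times> A \<Longrightarrow> sym_diff M N \<notin> rect_ball A r \<Longrightarrow> dist (F M) (F N) \<ge> real r"
proof -
  define g where "g M W = real (rect_rank A r (sym_diff M W))" for M W
  have fin: "finite (Pow (A \<times> A))" and r: "real r > 0"
    using assms by simp_all
  have g: "g M W \<in> {0..real r}" for M W
    by (simp add: g_def rect_rank_le)
  obtain F :: "('a \<times> 'a) set \<Rightarrow> diagram" where
    F: "\<And>u v c. c \<ge> 0 \<Longrightarrow> dist (F u) (F v) \<le> c \<longleftrightarrow> (\<forall>i\<in>Pow (A \<times> A). \<bar>g u i - g v i\<bar> \<le> c)"
    using cube_embeds_in_diagrams[of "Pow (A \<times> A)" "real r" g, OF fin r g] by blast
  show thesis
  proof (rule that)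
    fix M and X Y :: "'a set"
    assume XY: "X \<subseteq> A" "Y \<subseteq> A"
    have "sym_diff (sym_diff M (X \<times> Y)) W = sym_diff (sym_diff M W) (X \<times> Y)" for W
      by auto
    then have "\<bar>g M W - g (sym_diff M (X \<times> Y)) W\<bar> \<le> 1" for W
      using rect_rank_lipschitz[OF XY, of r "sym_diff M W"]
      by (simp only: g_def abs_minus_commute)
    then show "dist (F M) (F (sym_diff M (X \<times> Y))) \<le> 1"
      using F[of 1] by simp
  next
    fix M N :: "('a \<times> 'a) set"
    assume N: "N \<subseteq> A \<times> A" "sym_diff M N \<notin> rect_ball A r"
    have "\<bar>g M N - g N N\<bar> \<le> dist (F M) (F N)"
      using F[of "dist (F M) (F N)" M N] N(1) by simp
    then show "dist (F M) (F N) \<ge> real r"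
      using rect_rank_outside[OF N(2)] by (simp add: g_def rect_rank_empty)
  qed
qed

section \<open>No coarse embedding\<close>

text \<open>At least half of the pairs of vertices of the graph have images at distance at least \<open>a\<close>, so
  that the mean square distance over all pairs is at least \<open>a\<^sup>2 / 2\<close>; the spectral gap bounds it by
  \<open>2 * b\<^sup>2\<close>. The bound is the same for every \<open>r\<close>.\<close>

lemma compression_bound:
  fixes f :: "diagram \<Rightarrow> 'h :: real_inner"
  assumes upper: "\<And>x y. dist x y \<le> 1 \<Longrightarrow> norm (f x - f y) \<le> b"
    and lower: "\<And>x y. dist x y \<ge> real r \<Longrightarrow> norm (f x - f y) \<ge> a"
    and "r > 0" "a \<ge> 0"
  shows "a\<^sup>2 \<le> 4 * b\<^sup>2"
proof -
  \<comment> \<open>The size is chosen to make \<open>1 + 2 * card A * r \<le> card A * card A\<close>.\<close>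
  define A where "A = {..<2 * r + 1}"
  define G where "G = Pow (A \<times> A)"
  define R where "R = Pow A \<times> Pow A"
  define n where "n = real (card G)"
  have A: "finite A" "card A = 2 * r + 1"
    by (simp_all add: A_def)
  have G: "finite G" "card G = 2 ^ card (A \<times> A)"
    using A by (simp_all add: G_def card_Pow)
  have "n > 0"
    using G by (simp add: n_def)
  have R: "card R > 0"
    using A by (simp add: R_def card_Pow card_cartesian_product)
  obtain F :: "(nat \<times> nat) set \<Rightarrow> diagram" where
    near: "\<And>M X Y. X \<subseteq> A \<Longrightarrow> Y \<subseteq> A \<Longrightarrow> dist (F M) (F (sym_diff M (X \<times> Y))) \<le> 1" and
    far: "\<And>M N. N \<subseteq> A \<times> A \<Longrightarrow> sym_diff M N \<notin> rect_ball A r \<Longrightarrow> dist (F M) (F N) \<ge> real r"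
    using rank_metric_in_diagrams[OF A(1) assms(3)] by blast
  define h where "h M = f (F M)" for M
  have step: "norm (h M - h (sym_diff M (fst i \<times> snd i))) \<le> b" if "i \<in> R" for i M
    unfolding h_def by (rule upper, rule near) (use that in \<open>auto simp: R_def\<close>)
  have poincare: "(1 - 1 / 2) * card R * (\<Sum>M\<in>Pow (A \<times> A). \<Sum>N\<in>Pow (A \<times> A). (norm (h M - h N))\<^sup>2) \<le>
      2 ^ card (A \<times> A) *
        (\<Sum>i\<in>R. \<Sum>M\<in>Pow (A \<times> A). (norm (h M - h (sym_diff M (fst i \<times> snd i))))\<^sup>2)"
  proof (rule poincare_power_set)
    fix B assume "B \<subseteq> A \<times> A" "B \<noteq> {}"
    from sum_walsh_rectangles[OF A(1) this]
    show "(\<Sum>i\<in>R. walsh B (fst i \<times> snd i)) \<le> 1 / 2 * card R"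
      by (simp only: R_def case_prod_unfold)
  qed (use A in \<open>auto simp: R_def\<close>)
  have "2 * card (rect_ball A r) \<le> 2 * 2 ^ (2 * card A * r)"
    using card_rect_ball[OF A(1), of r] by simp
  also have "\<dots> \<le> 2 ^ Suc (2 * card A * r)"
    by simp
  also have "\<dots> \<le> 2 ^ (card A * card A)"
    by (intro power_increasing) (auto simp: A)
  finally have half: "2 * card (rect_ball A r) \<le> card G"
    by (simp add: G card_cartesian_product)
  have "n / 2 * a\<^sup>2 \<le> (\<Sum>N\<in>G. (norm (h M - h N))\<^sup>2)" if M: "M \<in> G" for M
  proof -
    let ?far = "{N \<in> G. sym_diff M N \<notin> rect_ball A r}"
    have "card {N \<in> G. sym_diff M N \<in> rect_ball A r} \<le> card (rect_ball A r)"
      using card_rect_ball[OF A(1), of r]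
      by (intro card_inj_on_le[where f = "\<lambda>N. sym_diff M N"]) (auto simp: inj_on_def)
    moreover have "card G = card ?far + card {N \<in> G. sym_diff M N \<in> rect_ball A r}"
      using G(1) by (subst card_Un_disjoint[symmetric]) (auto intro: arg_cong[of _ _ card])
    ultimately have "n / 2 \<le> card ?far"
      using half by (simp add: n_def)
    then have "n / 2 * a\<^sup>2 \<le> (\<Sum>N\<in>?far. a\<^sup>2)"
      unfolding sum_constant by (intro mult_right_mono) auto
    also have "\<dots> \<le> (\<Sum>N\<in>?far. (norm (h M - h N))\<^sup>2)"
      using far[of _ M] lower assms(4) by (intro sum_mono power_mono) (auto simp: h_def G_def)
    also have "\<dots> \<le> (\<Sum>N\<in>G. (norm (h M - h N))\<^sup>2)"
      using G(1) by (intro sum_mono2) auto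
    finally show ?thesis .
  qed
  then have "(\<Sum>M\<in>G. n / 2 * a\<^sup>2) \<le> (\<Sum>M\<in>G. \<Sum>N\<in>G. (norm (h M - h N))\<^sup>2)"
    by (rule sum_mono)
  then have "1 / 2 * card R * (n * (n / 2 * a\<^sup>2)) \<le>
      1 / 2 * card R * (\<Sum>M\<in>G. \<Sum>N\<in>G. (norm (h M - h N))\<^sup>2)"
    by (intro mult_left_mono) (auto simp: n_def)
  also have "\<dots> \<le> n * (\<Sum>i\<in>R. \<Sum>M\<in>G. (norm (h M - h (sym_diff M (fst i \<times> snd i))))\<^sup>2)"
    using poincare by (simp add: n_def G(2) flip: G_def)
  also have "\<dots> \<le> n * (\<Sum>i\<in>R. \<Sum>M\<in>G. b\<^sup>2)"
    using step \<open>n > 0\<close> by (intro mult_left_mono sum_mono power_mono) auto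
  also have "\<dots> = 1 / 2 * card R * (n * (n / 2 * (4 * b\<^sup>2)))"
    by (simp add: n_def)
  finally show ?thesis
    using R \<open>n > 0\<close> by (simp add: mult_le_cancel_left_pos)
qed

theorem theorem4p3:
  shows "\<not> (\<exists>f :: diagram \<Rightarrow> 'h :: {real_inner, complete_space}. coarse_embedding f)"
proof
  assume "\<exists>f :: diagram \<Rightarrow> 'h. coarse_embedding f"
  then obtain f :: "diagram \<Rightarrow> 'h" and \<rho>1 \<rho>2 :: "real \<Rightarrow> real" where
    mono: "mono_on {0..} \<rho>1" "mono_on {0..} \<rho>2" and
    nonneg: "\<And>t. t \<ge> 0 \<Longrightarrow> \<rho>1 t \<ge> 0 \<and> \<rho>2 t \<ge> 0" and
    lim: "filterlim \<rho>1 at_top at_top" and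
    f: "\<And>x y. \<rho>1 (dist x y) \<le> dist (f x) (f y)" "\<And>x y. dist (f x) (f y) \<le> \<rho>2 (dist x y)"
    unfolding coarse_embedding_def by blast
  have bound: "\<rho>1 (real r) \<le> 2 * \<rho>2 1" if "r > 0" for r
  proof -
    have "(\<rho>1 (real r))\<^sup>2 \<le> 4 * (\<rho>2 1)\<^sup>2"
    proof (rule compression_bound[of f])
      fix x y :: diagram
      show "norm (f x - f y) \<le> \<rho>2 1" if "dist x y \<le> 1"
        using f(2)[of x y] mono_onD[OF mono(2), of "dist x y" 1] that by (simp add: dist_norm)
      show "norm (f x - f y) \<ge> \<rho>1 (real r)" if "dist x y \<ge> real r"
        using f(1)[of x y] mono_onD[OF mono(1), of "real r" "dist x y"] that
        by (simp add: dist_norm)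
    qed (use that nonneg in auto)
    also have "\<dots> = (2 * \<rho>2 1)\<^sup>2"
      by (simp add: power_mult_distrib)
    finally show ?thesis
      by (rule power2_le_imp_le) (use nonneg[of 1] in simp)
  qed
  have "filterlim (\<lambda>r. \<rho>1 (real r)) at_top sequentially"
    using lim filterlim_real_sequentially by (rule filterlim_compose)
  then have "eventually (\<lambda>r. \<rho>1 (real r) > 2 * \<rho>2 1) sequentially"
    by (simp add: filterlim_at_top_dense)
  then have "eventually (\<lambda>r. \<rho>1 (real r) > 2 * \<rho>2 1 \<and> r > 0) sequentially"
    using eventually_gt_at_top by (rule eventually_conj)
  then obtain r where "\<rho>1 (real r) > 2 * \<rho>2 1" "r > 0"
    using eventually_happens'[OF sequentially_bot] by blast
  then show False
    using bound[of r] by simp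
qed

end
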